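(* Let $\mathfrak{A}$ be a unital $C^*$-algebra and let $x\in\mathfrak{A}$. Then the following hold. (i) $\sup_{\theta\in\mathbb{R}}\|\operatorname{Re}(e^{i\theta}x)\| = v(x)$. (ii) $\sup_{\theta\in\mathbb{R}}\|\operatorname{Im}(e^{i\theta}x)\| = v(x)$.
   Context: $\mathfrak{A}$ is a (nonzero, complex) $C^*$-algebra with unit $e$. For $x\in\mathfrak{A}$, $\operatorname{Re}(x)=\frac12(x+x^* )$ and $\operatorname{Im}(x)=\frac{1}{2i}(x-x^* )$. The set of normalized states is $\mathcal{S}(\mathfrak{A})=\{\varphi\in\mathfrak{A}':\varphi(e)=\|\varphi\|=1\}$, where $\mathfrak{A}'$ is the dual space of $\mathfrak{A}$. The numerical radius of $x$ is $v(x)=\sup\{|\varphi(x)|:\varphi\in\mathcal{S}(\mathfrak{A})\}$. *)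

theory Defs
  imports "HOL-Analysis.Analysis"
begin

text \<open>
  The distribution has no complex normed spaces, so complex scalar multiplication is added to the
  real Banach algebra classes. The class \<^class>\<open>real_normed_algebra_1\<close> contributes \<open>0 \<noteq> 1\<close>,
  submultiplicativity of the norm and \<open>norm 1 = 1\<close>; in a nonzero unital C*-algebra the latter
  is a consequence of the C*-identity, hence no restriction.
\<close>

class complex_banach_algebra_1 = real_normed_algebra_1 + banach +
  fixes scaleC :: "complex \<Rightarrow> 'a \<Rightarrow> 'a"  (infixr "*\<^sub>C" 75)
  assumes scaleC_add_right: "c *\<^sub>C (x + y) = c *\<^sub>C x + c *\<^sub>C y"
    and scaleC_add_left: "(c + d) *\<^sub>C x = c *\<^sub>C x + d *\<^sub>C x"
    and scaleC_scaleC: "c *\<^sub>C (d *\<^sub>C x) = (c * d) *\<^sub>C x"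
    and scaleR_scaleC: "r *\<^sub>R x = complex_of_real r *\<^sub>C x"
    and mult_scaleC_left: "(c *\<^sub>C x) * y = c *\<^sub>C (x * y)"
    and mult_scaleC_right: "x * (c *\<^sub>C y) = c *\<^sub>C (x * y)"
    and norm_scaleC: "norm (c *\<^sub>C x) = cmod c * norm x"

class cstar_algebra_1 = complex_banach_algebra_1 +
  fixes star :: "'a \<Rightarrow> 'a"
  assumes star_star: "star (star x) = x"
    and star_add: "star (x + y) = star x + star y"
    and star_scaleC: "star (c *\<^sub>C x) = cnj c *\<^sub>C star x"
    and star_mult: "star (x * y) = star y * star x"
    and cstar_identity: "norm (star x * x) = (norm x)\<^sup>2"

text \<open>The complex numbers are a model of the axioms.\<close>

instantiation complex :: cstar_algebra_1
begin

definition scaleC_complex :: "complex \<Rightarrow> complex \<Rightarrow> complex"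
  where "scaleC_complex c z = c * z"

definition star_complex :: "complex \<Rightarrow> complex"
  where "star_complex z = cnj z"

instance
  by standard
    (simp_all add: scaleC_complex_def star_complex_def algebra_simps norm_mult
      power2_eq_square scaleR_conv_of_real)

end

definition re_part :: "'a::cstar_algebra_1 \<Rightarrow> 'a"
  where "re_part x = (1 / 2) *\<^sub>C (x + star x)"

definition im_part :: "'a::cstar_algebra_1 \<Rightarrow> 'a"
  where "im_part x = (1 / (2 * \<i>)) *\<^sub>C (x - star x)"

definition dual_space :: "('a::complex_banach_algebra_1 \<Rightarrow> complex) set"
  where "dual_space = {\<phi>. bounded_linear \<phi> \<and> (\<forall>c x. \<phi> (c *\<^sub>C x) = c * \<phi> x)}"

text \<open>
  The dual norm is \<^const>\<open>onorm\<close>, the supremum of \<open>norm (\<phi> x) / norm x\<close>. It depends only on the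
  norms and so does not see whether the scalars are real or complex.
\<close>

definition states :: "('a::cstar_algebra_1 \<Rightarrow> complex) set"
  where "states = {\<phi> \<in> dual_space. \<phi> 1 = 1 \<and> onorm \<phi> = 1}"

text \<open>
  The supremum is taken in the reals; every value \<open>cmod (\<phi> x)\<close> is at most \<open>norm x\<close>.
\<close>

definition numerical_radius :: "'a::cstar_algebra_1 \<Rightarrow> real"
  where "numerical_radius x = (SUP \<phi>\<in>states. cmod (\<phi> x))"

end

theory Submission
  imports Defs "HOL-Complex_Analysis.Cauchy_Integral_Formula"
begin

text \<open>
  States are real on self-adjoint elements, so \<open>\<phi> (Re y) = Re (\<phi> y)\<close>; choosing the rotation that makes
  \<open>\<phi> x\<close> positive gives \<open>v(x) \<le> sup\<close>. The converse reduces to \<open>norm h \<le> v(h)\<close> for self-adjoint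
  \<open>h\<close>. By Hahn--Banach the largest real part of a state at \<open>h\<close> is \<open>inf {norm (h + t) - t | t \<ge> 0}\<close>,
  so \<open>norm (t \<plusminus> h) \<le> t + M\<close> for \<open>M > v(h)\<close> and large real \<open>t\<close>. The C*-identity turns this into
  \<open>norm (w + h) \<le> R + M'\<close> on a large circle \<open>cmod w = R\<close>, for any \<open>M' > M\<close>. Cauchy's estimate for
  the coefficients of \<open>(w + h) ^ K\<close>, together with \<open>norm (h ^ n) = norm h ^ n\<close>, then gives
  \<open>(R + norm h) ^ K \<le> (K + 1) (R + M') ^ K\<close> for all \<open>K\<close>, hence \<open>norm h \<le> M'\<close>. This avoids spectral
  theory. Part (ii) is part (i) with \<open>\<theta>\<close> shifted by \<open>\<pi>/2\<close>.
\<close>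

section \<open>Sublinear functionals\<close>

definition sublinear :: "('v::real_vector \<Rightarrow> real) \<Rightarrow> bool"
  where "sublinear p \<longleftrightarrow> (\<forall>x y. p (x + y) \<le> p x + p y) \<and> (\<forall>c x. 0 \<le> c \<longrightarrow> p (c *\<^sub>R x) = c * p x)"

lemma sublinear_add: "sublinear p \<Longrightarrow> p (x + y) \<le> p x + p y"
  and sublinear_scaleR: "sublinear p \<Longrightarrow> 0 \<le> c \<Longrightarrow> p (c *\<^sub>R x) = c * p x"
  by (auto simp: sublinear_def)

lemma sublinear_zero: "sublinear p \<Longrightarrow> p 0 = 0"
  using sublinear_scaleR[of p 0 0] by simp

lemma sublinear_minus: "sublinear p \<Longrightarrow> - p (- x) \<le> p x"
  using sublinear_add[of p x "- x"] sublinear_zero[of p] by simp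

lemma sublinearI:
  assumes "\<And>x y. p (x + y) \<le> p x + p y" "p 0 = 0" "\<And>c x. 0 < c \<Longrightarrow> p (c *\<^sub>R x) \<le> c * p x"
  shows "sublinear p"
proof -
  have "p (c *\<^sub>R x) = c * p x" if "0 \<le> c" for c x
  proof (cases "c = 0")
    case False
    then have "0 < c" using that by simp
    then have "p x \<le> inverse c * p (c *\<^sub>R x)"
      using assms(3)[of "inverse c" "c *\<^sub>R x"] by simp
    then have "c * p x \<le> p (c *\<^sub>R x)"
      using \<open>0 < c\<close> by (simp add: field_simps)
    then show ?thesis using assms(3)[OF \<open>0 < c\<close>, of x] by simp
  qed (simp add: assms)
  then show ?thesis using assms(1) by (simp add: sublinear_def)
qed

lemma sublinear_norm: "sublinear (norm :: 'v::real_normed_vector \<Rightarrow> real)"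
  by (simp add: sublinear_def norm_triangle_ineq)

text \<open>Sliding \<open>p\<close> along \<open>a\<close> gives a smaller sublinear functional, which is tight at \<open>- a\<close>. A
  sublinear functional that no slide lowers is additive; thus minimal sublinear functionals are
  linear, and Zorn's lemma yields Hahn--Banach without extending from subspaces.\<close>

definition slide :: "('v::real_vector \<Rightarrow> real) \<Rightarrow> 'v \<Rightarrow> 'v \<Rightarrow> real"
  where "slide p a x = (INF t\<in>{0..}. p (x + t *\<^sub>R a) - t * p a)"

context
  fixes p :: "'v::real_vector \<Rightarrow> real" and a :: 'v
  assumes p: "sublinear p"
begin

lemma bdd_below_slide: "bdd_below ((\<lambda>t. p (x + t *\<^sub>R a) - t * p a) ` {0..})"
proof (rule bdd_belowI2)
  fix t :: real assume "t \<in> {0..}"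
  then show "- p (- x) \<le> p (x + t *\<^sub>R a) - t * p a"
    using sublinear_add[OF p, of "x + t *\<^sub>R a" "- x"] sublinear_scaleR[OF p, of t a] by simp
qed

lemma slide_le: "0 \<le> t \<Longrightarrow> slide p a x \<le> p (x + t *\<^sub>R a) - t * p a"
  unfolding slide_def by (rule cINF_lower[OF bdd_below_slide]) simp

lemma slide_greatest: "(\<And>t. 0 \<le> t \<Longrightarrow> m \<le> p (x + t *\<^sub>R a) - t * p a) \<Longrightarrow> m \<le> slide p a x"
  unfolding slide_def by (rule cINF_greatest) auto

lemma slide_le_self: "slide p a x \<le> p x"
  using slide_le[of 0 x] by simp

lemma slide_minus: "slide p a (- a) \<le> - p a"
  using slide_le[of 1 "- a"] sublinear_zero[OF p] by simp

lemma sublinear_slide: "sublinear (slide p a)"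
proof (rule sublinearI)
  fix x y
  have "slide p a (x + y) - (p (y + s *\<^sub>R a) - s * p a) \<le> p (x + t *\<^sub>R a) - t * p a"
    if "0 \<le> s" "0 \<le> t" for s t
    using slide_le[of "t + s" "x + y"] that
      sublinear_add[OF p, of "x + t *\<^sub>R a" "y + s *\<^sub>R a"] by (simp add: algebra_simps)
  then have "slide p a (x + y) - (p (y + s *\<^sub>R a) - s * p a) \<le> slide p a x" if "0 \<le> s" for s
    using slide_greatest that by blast
  then have "slide p a (x + y) - slide p a x \<le> slide p a y"
    by (intro slide_greatest) (simp add: algebra_simps)
  then show "slide p a (x + y) \<le> slide p a x + slide p a y" by simp
next
  have "0 \<le> slide p a 0"
    by (rule slide_greatest) (simp add: sublinear_scaleR[OF p])
  then show "slide p a 0 = 0"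
    using slide_le_self[of 0] sublinear_zero[OF p] by simp
next
  fix c :: real and x assume c: "0 < c"
  have "inverse c * slide p a (c *\<^sub>R x) \<le> slide p a x"
  proof (rule slide_greatest)
    fix t :: real assume t: "0 \<le> t"
    have "slide p a (c *\<^sub>R x) \<le> p (c *\<^sub>R (x + t *\<^sub>R a)) - c * t * p a"
      using slide_le[of "c * t" "c *\<^sub>R x"] c t by (simp add: algebra_simps)
    then show "inverse c * slide p a (c *\<^sub>R x) \<le> p (x + t *\<^sub>R a) - t * p a"
      using c sublinear_scaleR[OF p, of c "x + t *\<^sub>R a"] by (simp add: field_simps)
  qed
  then show "slide p a (c *\<^sub>R x) \<le> c * slide p a x"
    using c by (simp add: field_simps)
qed

end

lemma linear_if_minimal_sublinear:
  assumes q: "sublinear q" and min: "\<And>q'. sublinear q' \<Longrightarrow> (\<forall>x. q' x \<le> q x) \<Longrightarrow> q' = q"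
  shows "linear q"
proof -
  have "q (x + a) = q x + q a" for x a
  proof -
    have "slide q a = q"
      using sublinear_slide[OF q] slide_le_self[OF q] by (intro min) auto
    then have "q x \<le> q (x + a) - q a"
      using slide_le[OF q, of 1 a x] by simp
    then show ?thesis using sublinear_add[OF q, of x a] by simp
  qed
  note add = this
  have neg: "q (- x) = - q x" for x
    using add[of x "- x"] sublinear_zero[OF q] by simp
  have "q (c *\<^sub>R x) = c * q x" for c x
  proof (cases "0 \<le> c")
    case False
    then show ?thesis
      using sublinear_scaleR[OF q, of "- c" x] neg[of "c *\<^sub>R x"] by simp
  qed (rule sublinear_scaleR[OF q])
  then show ?thesis using add by (intro linearI) auto
qed

lemma sublinear_Inf_chain:
  assumes C: "C \<noteq> {}" "\<And>q. q \<in> C \<Longrightarrow> sublinear q" "\<And>q. q \<in> C \<Longrightarrow> \<forall>x. q x \<le> p x"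
    and chain: "\<And>q r. q \<in> C \<Longrightarrow> r \<in> C \<Longrightarrow> (\<forall>x. q x \<le> r x) \<or> (\<forall>x. r x \<le> q x)"
  shows "sublinear (\<lambda>x. INF q\<in>C. q x) \<and> (\<forall>q\<in>C. \<forall>x. (INF q\<in>C. q x) \<le> q x)"
proof -
  let ?m = "\<lambda>x. INF q\<in>C. q x"
  have bdd: "bdd_below ((\<lambda>q. q x) ` C)" for x
  proof (rule bdd_belowI2)
    fix q assume "q \<in> C"
    then show "- p (- x) \<le> q x"
      using C(3)[of q] sublinear_minus[OF C(2), of q x] by (smt (verit))
  qed
  have low: "?m x \<le> q x" if "q \<in> C" for q x
    by (rule cINF_lower[OF bdd that])
  have "sublinear ?m"
  proof (rule sublinearI)
    fix x y
    have "?m (x + y) - r y \<le> q x" if "q \<in> C" "r \<in> C" for q r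
      using chain[OF that] low[OF that(1), of "x + y"] low[OF that(2), of "x + y"]
        sublinear_add[OF C(2)[OF that(1)], of x y] sublinear_add[OF C(2)[OF that(2)], of x y]
      by (smt (verit))
    then have "?m (x + y) - r y \<le> ?m x" if "r \<in> C" for r
      using that by (intro cINF_greatest[OF C(1)]) auto
    then have "?m (x + y) - ?m x \<le> ?m y"
      by (intro cINF_greatest[OF C(1)]) (simp add: algebra_simps)
    then show "?m (x + y) \<le> ?m x + ?m y" by simp
  next
    have "(\<lambda>q. q 0) ` C = {0}"
      using C(1) sublinear_zero[OF C(2)] by force
    then show "?m 0 = 0" by simp
  next
    fix c :: real and x assume c: "0 < c"
    have "inverse c * ?m (c *\<^sub>R x) \<le> ?m x"
    proof (rule cINF_greatest[OF C(1)])
      fix q assume "q \<in> C"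
      then show "inverse c * ?m (c *\<^sub>R x) \<le> q x"
        using c low[of q "c *\<^sub>R x"] sublinear_scaleR[OF C(2), of q c x] by (simp add: field_simps)
    qed
    then show "?m (c *\<^sub>R x) \<le> c * ?m x"
      using c by (simp add: field_simps)
  qed
  then show ?thesis using low by blast
qed

lemma linear_below_sublinear:
  assumes p: "sublinear p"
  obtains f where "linear f" "\<And>x. f x \<le> p x"
proof -
  define A where "A = {q. sublinear q \<and> (\<forall>x. q x \<le> p x)}"
  let ?P = "\<lambda>q r. \<forall>x. r x \<le> (q x :: real)"
  have "\<exists>m\<in>A. \<forall>a\<in>A. ?P m a \<longrightarrow> a = m"
  proof (rule predicate_Zorn)
    show "partial_order_on A (relation_of ?P A)"
      by (rule partial_order_on_relation_ofI) (auto intro: order_trans simp: fun_eq_iff order_antisym)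
  next
    fix C assume "C \<in> Chains (relation_of ?P A)"
    then have sub: "C \<subseteq> A" and chain: "\<And>q r. q \<in> C \<Longrightarrow> r \<in> C \<Longrightarrow> ?P q r \<or> ?P r q"
      by (auto simp: Chains_def relation_of_def)
    show "\<exists>u\<in>A. \<forall>a\<in>C. ?P a u"
    proof (cases "C = {}")
      case True
      then show ?thesis using p by (auto simp: A_def)
    next
      case False
      have *: "sublinear (\<lambda>x. INF q\<in>C. q x) \<and> (\<forall>q\<in>C. \<forall>x. (INF q\<in>C. q x) \<le> q x)"
        using sub chain False by (intro sublinear_Inf_chain[where p = p]) (auto simp: A_def)
      then have "(\<lambda>x. INF q\<in>C. q x) \<in> A"
        using False sub unfolding A_def by (smt (verit) all_not_in_conv mem_Collect_eq subsetD)
      then show ?thesis using * by (intro bexI[of _ "\<lambda>x. INF q\<in>C. q x"]) auto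
    qed
  qed
  then obtain m where m: "m \<in> A" "\<And>q. q \<in> A \<Longrightarrow> ?P m q \<Longrightarrow> q = m" by blast
  have "linear m"
  proof (rule linear_if_minimal_sublinear)
    show "sublinear m" using m by (simp add: A_def)
    show "q = m" if "sublinear q" "\<forall>x. q x \<le> m x" for q
      using that m by (intro m(2)) (auto simp: A_def intro: order_trans)
  qed
  then show thesis using that m by (auto simp: A_def)
qed

theorem Hahn_Banach_sublinear:
  assumes p: "sublinear p"
  obtains f where "linear f" "\<And>x. f x \<le> p x" "f a = p a"
proof -
  obtain f where f: "linear f" "\<And>x. f x \<le> slide p a x"
    using linear_below_sublinear[OF sublinear_slide[OF p]] by blast
  have le: "f x \<le> p x" for x
    using f(2)[of x] slide_le_self[OF p, of a x] by linarith
  have "f (- a) \<le> - p a"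
    using f(2)[of "- a"] slide_minus[OF p, of a] by linarith
  then show thesis using that f(1) le[of a] le by (simp add: linear_neg)
qed

section \<open>Complex functionals\<close>

lemma scaleC_one [simp]: "1 *\<^sub>C x = (x::'a::complex_banach_algebra_1)"
  using scaleR_scaleC[of 1 x] by simp

lemma scaleC_minus1: "(- 1) *\<^sub>C x = - (x::'a::complex_banach_algebra_1)"
  using scaleR_scaleC[of "- 1" x] by simp

lemma scaleC_minus_left: "(- c) *\<^sub>C x = - (c *\<^sub>C (x::'a::complex_banach_algebra_1))"
  using scaleC_scaleC[of "- 1" c x] scaleC_minus1[of "c *\<^sub>C x"] by simp

lemma scaleC_minus_right: "c *\<^sub>C (- x) = - (c *\<^sub>C (x::'a::complex_banach_algebra_1))"
  using scaleC_scaleC[of c "- 1" x] scaleC_minus1[of x] scaleC_minus_left[of c x] by simp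

lemma scaleC_diff_right: "c *\<^sub>C (x - y) = c *\<^sub>C x - c *\<^sub>C (y::'a::complex_banach_algebra_1)"
  using scaleC_add_right[of c x "- y"] by (simp add: scaleC_minus_right)

lemma scaleC_complex_split:
  "c *\<^sub>C x = Re c *\<^sub>R x + Im c *\<^sub>R (\<i> *\<^sub>C (x::'a::complex_banach_algebra_1))"
proof -
  have "c *\<^sub>C x = (complex_of_real (Re c) + complex_of_real (Im c) * \<i>) *\<^sub>C x"
    by (simp add: mult.commute flip: complex_eq)
  also have "\<dots> = Re c *\<^sub>R x + Im c *\<^sub>R (\<i> *\<^sub>C x)"
    by (simp only: scaleC_add_left scaleR_scaleC scaleC_scaleC)
  finally show ?thesis .
qed

lemma dual_space_scaleC: "\<phi> \<in> dual_space \<Longrightarrow> \<phi> (c *\<^sub>C x) = c * \<phi> x"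
  by (simp add: dual_space_def)

lemma dual_space_linear: "\<phi> \<in> dual_space \<Longrightarrow> linear \<phi>"
  by (simp add: dual_space_def bounded_linear.linear)

lemma unit_rotation:
  obtains \<theta> :: real where "exp (\<i> * complex_of_real \<theta>) * z = complex_of_real (cmod z)"
proof
  show "exp (\<i> * complex_of_real (- Arg z)) * z = complex_of_real (cmod z)"
    using Arg_eq[of z] by (cases "z = 0") (auto simp: exp_minus field_simps)
qed

lemma complex_Hahn_Banach:
  fixes a :: "'a::complex_banach_algebra_1"
  assumes p: "sublinear p" "\<And>x. p x \<le> norm x"
  obtains \<phi> where "\<phi> \<in> dual_space" "\<And>x. Re (\<phi> x) \<le> p x" "Re (\<phi> a) = p a" "\<And>x. cmod (\<phi> x) \<le> norm x"
proof -
  obtain f where f: "linear f" "\<And>x. f x \<le> p x" "f a = p a"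
    using Hahn_Banach_sublinear[OF p(1)] by blast
  define \<phi> where "\<phi> x = Complex (f x) (- f (\<i> *\<^sub>C x))" for x
  have Re: "Re (\<phi> x) = f x" for x by (simp add: \<phi>_def)
  have add: "\<phi> (x + y) = \<phi> x + \<phi> y" for x y
    by (simp add: \<phi>_def scaleC_add_right linear_add[OF f(1)] complex_eq_iff)
  have fC: "f (c *\<^sub>C x) = Re c * f x + Im c * f (\<i> *\<^sub>C x)" for c x
    unfolding scaleC_complex_split[of c x]
    by (simp add: linear_add[OF f(1)] linear_scale[OF f(1)])
  have scale: "\<phi> (c *\<^sub>C x) = c * \<phi> x" for c x
    unfolding \<phi>_def scaleC_scaleC fC[of c] fC[of "\<i> * c"]
    by (simp add: complex_eq_iff algebra_simps)
  have bound: "cmod (\<phi> x) \<le> norm x" for x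
  proof -
    obtain \<theta> where \<theta>: "exp (\<i> * complex_of_real \<theta>) * \<phi> x = complex_of_real (cmod (\<phi> x))"
      using unit_rotation by blast
    have "cmod (\<phi> x) = Re (\<phi> (exp (\<i> * complex_of_real \<theta>) *\<^sub>C x))"
      using \<theta> by (simp add: scale)
    also have "\<dots> \<le> norm (exp (\<i> * complex_of_real \<theta>) *\<^sub>C x)"
      unfolding Re using f(2) p(2) order_trans by blast
    finally show ?thesis by (simp add: norm_scaleC)
  qed
  have "bounded_linear \<phi>"
    using add bound scale
    by (intro bounded_linear_intro[where K = 1])
      (auto simp: scaleR_scaleC[where 'a = 'a] scaleR_conv_of_real)
  then have "\<phi> \<in> dual_space" using scale by (simp add: dual_space_def)
  then show thesis using that bound f by (simp add: Re)
qed

lemma state_bound: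
  assumes "\<phi> \<in> states"
  shows "cmod (\<phi> x) \<le> norm x"
  using onorm[of \<phi> x] assms by (simp add: states_def dual_space_def)

lemma state_one: "\<phi> \<in> states \<Longrightarrow> \<phi> 1 = 1"
  and state_dual: "\<phi> \<in> states \<Longrightarrow> \<phi> \<in> dual_space"
  by (simp_all add: states_def)

text \<open>The value \<open>slide norm 1 a\<close> is the infimum of \<open>norm (a + t1) - t\<close>, the largest real part
  that a state can take at \<open>a\<close>.\<close>

lemma state_attaining_slide:
  fixes a :: "'a::cstar_algebra_1"
  obtains \<phi> where "\<phi> \<in> states" "Re (\<phi> a) = slide norm 1 a"
proof -
  obtain \<phi> where \<phi>: "\<phi> \<in> dual_space" "\<And>x. Re (\<phi> x) \<le> slide norm 1 x"
      "Re (\<phi> a) = slide norm 1 a" "\<And>x. cmod (\<phi> x) \<le> norm x"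
    using complex_Hahn_Banach[OF sublinear_slide[OF sublinear_norm] slide_le_self[OF sublinear_norm]]
    by blast
  have "Re (\<phi> (- 1)) \<le> - 1"
    using \<phi>(2)[of "- 1"] slide_minus[OF sublinear_norm, of "1::'a"] by simp
  then have re: "1 \<le> Re (\<phi> 1)"
    by (simp add: linear_neg[OF dual_space_linear[OF \<phi>(1)]])
  moreover have "cmod (\<phi> 1) \<le> 1" using \<phi>(4)[of 1] by simp
  ultimately have "Re (\<phi> 1) = 1" "cmod (\<phi> 1) = 1"
    using complex_Re_le_cmod[of "\<phi> 1"] by linarith+
  then have one: "\<phi> 1 = 1"
    using cmod_power2[of "\<phi> 1"] by (simp add: complex_eq_iff)
  have "onorm \<phi> = 1"
  proof (rule antisym)
    show "onorm \<phi> \<le> 1" by (rule onorm_bound) (use \<phi>(4) in auto)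
    show "1 \<le> onorm \<phi>"
      using onorm[of \<phi> 1] \<phi>(1) one by (simp add: dual_space_def)
  qed
  then show thesis using that \<phi> one by (simp add: states_def)
qed

section \<open>Self-adjoint elements\<close>

lemma star_scaleR: "star (r *\<^sub>R x) = r *\<^sub>R star (x::'a::cstar_algebra_1)"
  by (simp add: scaleR_scaleC star_scaleC)

lemma star_minus: "star (- x) = - star (x::'a::cstar_algebra_1)"
  using star_scaleR[of "- 1" x] by simp

lemma star_diff: "star (x - y) = star x - star (y::'a::cstar_algebra_1)"
  using star_add[of x "- y"] by (simp add: star_minus)

lemma star_one: "star 1 = (1::'a::cstar_algebra_1)"
  by (metis mult_1_left mult_1_right star_mult star_star)

lemma star_power: "star (x ^ n) = star (x::'a::cstar_algebra_1) ^ n"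
  by (induction n) (simp_all add: star_one star_mult power_commutes)

lemma norm_selfadjoint_square:
  fixes h :: "'a::cstar_algebra_1"
  assumes "star h = h"
  shows "norm (h ^ 2) = norm h ^ 2"
  using cstar_identity[of h] assms by (simp add: power2_eq_square)

lemma norm_selfadjoint_power:
  fixes h :: "'a::cstar_algebra_1"
  assumes h: "star h = h"
  shows "norm (h ^ n) = norm h ^ n"
proof (cases "h = 0")
  case True
  then show ?thesis by (cases n) auto
next
  case False
  have two: "norm (h ^ (2 ^ k)) = norm h ^ (2 ^ k)" for k
  proof (induction k)
    case (Suc k)
    have "star (h ^ (2 ^ k)) = h ^ (2 ^ k)" by (simp add: star_power h)
    from norm_selfadjoint_square[OF this] Suc show ?case
      by (simp add: power_mult[symmetric] mult.commute)
  qed simp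
  have n: "n \<le> 2 ^ n" by simp
  have "norm h ^ n * norm h ^ (2 ^ n - n) = norm (h ^ n * h ^ (2 ^ n - n))"
    using n two[of n] by (simp flip: power_add)
  also have "\<dots> \<le> norm (h ^ n) * norm h ^ (2 ^ n - n)"
    by (rule order_trans[OF norm_mult_ineq]) (simp add: mult_left_mono norm_power_ineq)
  finally have "norm h ^ n \<le> norm (h ^ n)" using False by simp
  then show ?thesis using norm_power_ineq[of h n] by simp
qed

lemma norm_scalar_plus_selfadjoint:
  fixes h :: "'a::cstar_algebra_1"
  assumes h: "star h = h"
  shows "(norm (w *\<^sub>C 1 + h))\<^sup>2 \<le> norm ((cmod w)\<^sup>2 *\<^sub>R 1 + (2 * Re w) *\<^sub>R h) + (norm h)\<^sup>2"
proof -
  have "star (w *\<^sub>C 1 + h) * (w *\<^sub>C 1 + h) = (cnj w *\<^sub>C 1 + h) * (w *\<^sub>C 1 + h)"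
    by (simp add: star_add star_scaleC star_one h)
  also have "\<dots> = (cnj w * w) *\<^sub>C 1 + (cnj w + w) *\<^sub>C h + h\<^sup>2"
    by (simp add: distrib_left distrib_right mult_scaleC_left mult_scaleC_right scaleC_scaleC
        scaleC_add_left scaleC_add_right power2_eq_square mult.commute[of w])
  also have "cnj w * w = complex_of_real ((cmod w)\<^sup>2)"
    by (simp add: complex_norm_square mult.commute del: of_real_power)
  also have "cnj w + w = complex_of_real (2 * Re w)"
    by (simp add: complex_eq_iff)
  finally have "star (w *\<^sub>C 1 + h) * (w *\<^sub>C 1 + h)
      = (cmod w)\<^sup>2 *\<^sub>R 1 + (2 * Re w) *\<^sub>R h + h\<^sup>2"
    by (simp only: scaleR_scaleC)
  then show ?thesis
    using cstar_identity[of "w *\<^sub>C 1 + h"] norm_selfadjoint_square[OF h]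
      norm_triangle_ineq[of "(cmod w)\<^sup>2 *\<^sub>R 1 + (2 * Re w) *\<^sub>R h" "h\<^sup>2"] by simp
qed

lemma state_selfadjoint_real:
  fixes h :: "'a::cstar_algebra_1"
  assumes \<phi>: "\<phi> \<in> states" and h: "star h = h"
  shows "Im (\<phi> h) = 0"
proof (rule ccontr)
  define b where "b = Im (\<phi> h)"
  assume "Im (\<phi> h) \<noteq> 0"
  then have b: "b \<noteq> 0" by (simp add: b_def)
  define t where "t = (norm h)\<^sup>2 / b"
  define w where "w = \<i> * complex_of_real t"
  have w: "Re w = 0" "Im w = t" "cmod w = \<bar>t\<bar>" by (simp_all add: w_def norm_mult)
  have "\<phi> (w *\<^sub>C 1 + h) = w + \<phi> h"
    using linear_add[OF dual_space_linear[OF state_dual[OF \<phi>]]]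
    by (simp add: dual_space_scaleC[OF state_dual[OF \<phi>]] state_one[OF \<phi>])
  then have "\<bar>t + b\<bar> \<le> norm (w *\<^sub>C 1 + h)"
    using state_bound[OF \<phi>, of "w *\<^sub>C 1 + h"] abs_Im_le_cmod[of "w + \<phi> h"] by (simp add: w b_def)
  then have "(t + b)\<^sup>2 \<le> (norm (w *\<^sub>C 1 + h))\<^sup>2"
    by (metis abs_ge_zero power2_abs power_mono)
  also have "\<dots> \<le> t\<^sup>2 + (norm h)\<^sup>2"
    using norm_scalar_plus_selfadjoint[OF h, of w] by (simp add: w)
  finally have "2 * (t * b) + b\<^sup>2 \<le> (norm h)\<^sup>2"
    by (simp add: power2_eq_square algebra_simps)
  moreover have "t * b = (norm h)\<^sup>2" using b by (simp add: t_def)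
  moreover have "0 < b\<^sup>2" using b by simp
  ultimately show False by (smt (verit) zero_le_power2)
qed

lemma Cauchy_coeff_bound:
  assumes "0 < R" and B: "\<And>z. cmod z = R \<Longrightarrow> cmod (poly p z) \<le> B"
  shows "cmod (coeff p n) * R ^ n \<le> B"
proof -
  have "(deriv ^^ n) (poly p) = poly ((pderiv ^^ n) p)"
    by (induction n) (auto simp: DERIV_imp_deriv[OF poly_DERIV])
  then have "(deriv ^^ n) (poly p) 0 = fact n * coeff p n"
    by (simp add: poly_0_coeff_0 coeff_higher_pderiv pochhammer_fact)
  moreover have "cmod ((deriv ^^ n) (poly p) 0) \<le> fact n * B / R ^ n"
    using assms
    by (intro Cauchy_inequality) (auto intro!: holomorphic_intros continuous_intros)
  ultimately show ?thesis
    using \<open>0 < R\<close> by (simp add: norm_mult field_simps)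
qed

lemma functional_binomial_poly:
  fixes h :: "'a::complex_banach_algebra_1"
  assumes "\<psi> \<in> dual_space"
  shows "\<exists>p. (\<forall>w. poly p w = \<psi> (h ^ m * (w *\<^sub>C 1 + h) ^ K))
           \<and> (\<forall>n. coeff p n = of_nat (K choose n) * \<psi> (h ^ (m + (K - n))))"
proof (induction K arbitrary: m)
  case 0
  show ?case
    by (rule exI[of _ "[:\<psi> (h ^ m):]"]) (auto simp: coeff_pCons split: nat.split)
next
  case (Suc K)
  obtain p where p: "\<And>w. poly p w = \<psi> (h ^ m * (w *\<^sub>C 1 + h) ^ K)"
      "\<And>n. coeff p n = of_nat (K choose n) * \<psi> (h ^ (m + (K - n)))" using Suc[of m] by blast
  obtain q where q: "\<And>w. poly q w = \<psi> (h ^ Suc m * (w *\<^sub>C 1 + h) ^ K)"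
      "\<And>n. coeff q n = of_nat (K choose n) * \<psi> (h ^ (Suc m + (K - n)))" using Suc[of "Suc m"] by blast
  have "poly (pCons 0 p + q) w = \<psi> (h ^ m * (w *\<^sub>C 1 + h) ^ Suc K)" for w
  proof -
    have "h ^ m * (w *\<^sub>C 1 + h) ^ Suc K
        = w *\<^sub>C (h ^ m * (w *\<^sub>C 1 + h) ^ K) + h ^ Suc m * (w *\<^sub>C 1 + h) ^ K"
    proof -
      have "h ^ m * (w *\<^sub>C 1 + h) ^ Suc K = (h ^ m * (w *\<^sub>C 1 + h)) * (w *\<^sub>C 1 + h) ^ K"
        by (simp add: mult.assoc)
      also have "h ^ m * (w *\<^sub>C 1 + h) = w *\<^sub>C h ^ m + h ^ Suc m"
        by (simp add: distrib_left mult_scaleC_right power_commutes)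
      finally show ?thesis by (simp only: distrib_right mult_scaleC_left)
    qed
    then show ?thesis
      using assms by (simp add: p(1) q(1) linear_add[OF dual_space_linear] dual_space_scaleC
          del: power_Suc)
  qed
  moreover have "coeff (pCons 0 p + q) n = of_nat (Suc K choose n) * \<psi> (h ^ (m + (Suc K - n)))" for n
  proof (cases n)
    case (Suc j)
    consider "j < K" | "K \<le> j" by linarith
    then show ?thesis
    proof cases
      case 1
      then have "Suc m + (K - Suc j) = m + (K - j)" by simp
      then show ?thesis using Suc by (simp add: p(2) q(2) algebra_simps del: power_Suc add_Suc)
    qed (simp add: Suc p(2) q(2) binomial_eq_0)
  qed (simp add: q(2))
  ultimately show ?case by blast
qed

lemma norm_le_if_scalar_translates:
  fixes h :: "'a::cstar_algebra_1"
  assumes h: "star h = h" and R: "0 < R" and M: "0 \<le> M"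
    and bound: "\<And>w. cmod w = R \<Longrightarrow> norm (w *\<^sub>C 1 + h) \<le> R + M"
  shows "norm h \<le> M"
proof (rule ccontr)
  assume "\<not> norm h \<le> M"
  define L where "L = norm h"
  have L: "M < L" using \<open>\<not> norm h \<le> M\<close> by (simp add: L_def)
  have coeff: "of_nat (K choose n) * R ^ n * L ^ (K - n) \<le> (R + M) ^ K" for K n
  proof -
    obtain \<psi> where \<psi>: "\<psi> \<in> dual_space" "Re (\<psi> (h ^ (K - n))) = norm (h ^ (K - n))"
        "\<And>x. cmod (\<psi> x) \<le> norm x"
      using complex_Hahn_Banach[OF sublinear_norm order_refl] by blast
    obtain p where p: "\<And>w. poly p w = \<psi> (h ^ 0 * (w *\<^sub>C 1 + h) ^ K)"
        "\<And>n. coeff p n = of_nat (K choose n) * \<psi> (h ^ (0 + (K - n)))"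
      using functional_binomial_poly[OF \<psi>(1)] by blast
    have "cmod (poly p z) \<le> (R + M) ^ K" if "cmod z = R" for z
    proof -
      have "cmod (poly p z) \<le> norm ((z *\<^sub>C 1 + h) ^ K)" using \<psi>(3) by (simp add: p)
      also have "\<dots> \<le> norm (z *\<^sub>C 1 + h) ^ K" by (rule norm_power_ineq)
      also have "\<dots> \<le> (R + M) ^ K" by (rule power_mono[OF bound[OF that]]) simp
      finally show ?thesis .
    qed
    from Cauchy_coeff_bound[OF R this]
    have "of_nat (K choose n) * cmod (\<psi> (h ^ (K - n))) * R ^ n \<le> (R + M) ^ K"
      by (simp add: p(2) norm_mult)
    moreover have "L ^ (K - n) \<le> cmod (\<psi> (h ^ (K - n)))"
      using complex_Re_le_cmod[of "\<psi> (h ^ (K - n))"] \<psi>(2) norm_selfadjoint_power[OF h]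
      by (simp add: L_def)
    then have "of_nat (K choose n) * L ^ (K - n) * R ^ n
        \<le> of_nat (K choose n) * cmod (\<psi> (h ^ (K - n))) * R ^ n"
      using R by (intro mult_right_mono mult_left_mono) auto
    ultimately show ?thesis by (simp add: mult_ac)
  qed
  define q where "q = (R + L) / (R + M)"
  have q: "1 < q" using L R M by (simp add: q_def field_simps)
  have le: "q ^ K \<le> real K + 1" for K
  proof -
    have "(R + L) ^ K = (\<Sum>n\<le>K. of_nat (K choose n) * R ^ n * L ^ (K - n))"
      by (rule binomial_ring)
    also have "\<dots> \<le> (\<Sum>n\<le>K. (R + M) ^ K)" by (rule sum_mono) (rule coeff)
    finally show ?thesis using R M by (simp add: q_def power_divide field_simps)
  qed
  have "(\<lambda>K. real K * (1 / q) ^ K + (1 / q) ^ K) \<longlonglongrightarrow> 0 + 0"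
    using q by (intro tendsto_add powser_times_n_limit_0 LIMSEQ_power_zero) auto
  then have "eventually (\<lambda>K. real K * (1 / q) ^ K + (1 / q) ^ K < 1) sequentially"
    by (intro order_tendstoD(2)) auto
  then obtain K where "real K * (1 / q) ^ K + (1 / q) ^ K < 1"
    by (meson eventually_happens' sequentially_bot)
  moreover have "0 < q ^ K" using q by simp
  ultimately have "real K + 1 < q ^ K"
    by (simp add: power_one_over flip: add_divide_distrib)
  then show False using le[of K] by simp
qed

section \<open>The numerical radius\<close>

lemma states_nonempty: "(states :: ('a::cstar_algebra_1 \<Rightarrow> complex) set) \<noteq> {}"
proof -
  obtain \<phi> :: "'a \<Rightarrow> complex" where "\<phi> \<in> states" by (rule state_attaining_slide[of 0])
  then show ?thesis by auto
qed

lemma numerical_radius_upper: "\<phi> \<in> states \<Longrightarrow> cmod (\<phi> x) \<le> numerical_radius x"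
  unfolding numerical_radius_def
  by (rule cSUP_upper) (auto intro!: bdd_aboveI2[where M = "norm x"] state_bound)

lemma numerical_radius_least: "(\<And>\<phi>. \<phi> \<in> states \<Longrightarrow> cmod (\<phi> x) \<le> m) \<Longrightarrow> numerical_radius x \<le> m"
  unfolding numerical_radius_def by (rule cSUP_least[OF states_nonempty])

lemma numerical_radius_nonneg: "0 \<le> numerical_radius (x::'a::cstar_algebra_1)"
proof -
  obtain \<phi> :: "'a \<Rightarrow> complex" where "\<phi> \<in> states" using states_nonempty by auto
  then show ?thesis using numerical_radius_upper[of \<phi> x] order_trans[OF norm_ge_zero] by auto
qed

lemma eventually_translate_bound:
  fixes h :: "'a::cstar_algebra_1"
  assumes "numerical_radius h < M"
  shows "\<forall>\<^sub>F t in at_top. norm (h + t *\<^sub>R 1) \<le> t + M"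
proof -
  obtain \<phi> where \<phi>: "\<phi> \<in> states" "Re (\<phi> h) = slide norm 1 h"
    by (rule state_attaining_slide)
  have "slide norm 1 h < M"
    using numerical_radius_upper[OF \<phi>(1), of h] complex_Re_le_cmod[of "\<phi> h"] \<phi>(2) assms by linarith
  then obtain s where s: "0 \<le> s" "norm (h + s *\<^sub>R 1) - s < M"
    using slide_greatest[OF sublinear_norm, of M h 1] by (auto simp: not_le) (meson not_le)
  have "norm (h + t *\<^sub>R 1) \<le> t + M" if "s \<le> t" for t
  proof -
    have "norm (h + t *\<^sub>R 1) = norm ((h + s *\<^sub>R 1) + (t - s) *\<^sub>R 1)"
      by (simp add: scaleR_left_diff_distrib)
    also have "\<dots> \<le> norm (h + s *\<^sub>R 1) + \<bar>t - s\<bar>"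
      by (rule order_trans[OF norm_triangle_ineq]) simp
    finally show ?thesis using s that by simp
  qed
  then show ?thesis using eventually_at_top_linorder by blast
qed

lemma numerical_radius_minus: "numerical_radius (- x) = numerical_radius x"
proof -
  have "(SUP \<phi>\<in>states. cmod (\<phi> (- x))) = (SUP \<phi>\<in>states. cmod (\<phi> x))"
    by (rule SUP_cong) (simp_all add: linear_neg[OF dual_space_linear[OF state_dual]])
  then show ?thesis by (simp add: numerical_radius_def)
qed

lemma norm_selfadjoint_le_numerical_radius:
  fixes h :: "'a::cstar_algebra_1"
  assumes h: "star h = h"
  shows "norm h \<le> numerical_radius h"
proof (rule dense_ge)
  fix M' assume "numerical_radius h < M'"
  then obtain M where M: "numerical_radius h < M" "M < M'" using dense by blast
  have M0: "0 < M" "0 < M'" using numerical_radius_nonneg[of h] M by linarith+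
  have "\<forall>\<^sub>F t in at_top. norm (h + t *\<^sub>R 1) \<le> t + M \<and> norm (- h + t *\<^sub>R 1) \<le> t + M"
    using eventually_translate_bound[of h M] eventually_translate_bound[of "- h" M] M
    by (auto simp: numerical_radius_minus intro: eventually_conj)
  then obtain s where s: "\<And>t. s \<le> t \<Longrightarrow> norm (h + t *\<^sub>R 1) \<le> t + M"
      "\<And>t. s \<le> t \<Longrightarrow> norm (- h + t *\<^sub>R 1) \<le> t + M"
    by (auto simp: eventually_at_top_linorder)
  define R where "R = max (max 1 (2 * s)) ((norm h)\<^sup>2 / (2 * (M' - M)))"
  have R: "0 < R" "2 * s \<le> R" "(norm h)\<^sup>2 / (2 * (M' - M)) \<le> R" by (auto simp: R_def)
  have R': "(norm h)\<^sup>2 \<le> 2 * R * (M' - M)" using R(3) M by (simp add: field_simps)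
  show "norm h \<le> M'"
  proof (rule norm_le_if_scalar_translates[OF h R(1)])
    show "0 \<le> M'" using M0 by simp
    fix w assume w: "cmod w = R"
    have "norm (R\<^sup>2 *\<^sub>R 1 + (2 * Re w) *\<^sub>R h) \<le> R\<^sup>2 + 2 * \<bar>Re w\<bar> * M"
    proof (cases "Re w = 0")
      case False
      define u where "u = \<bar>Re w\<bar>"
      have u: "0 < u" "u \<le> R" using False abs_Re_le_cmod[of w] w by (simp_all add: u_def)
      define t where "t = R\<^sup>2 / (2 * u)"
      have tu: "2 * u * t = R\<^sup>2" using u by (simp add: t_def)
      have "R / 2 \<le> t"
        using u R(1) by (simp add: t_def field_simps power2_eq_square)
      then have "s \<le> t" using R(2) by simp
      have "norm (R\<^sup>2 *\<^sub>R 1 + (2 * Re w) *\<^sub>R h) = norm ((2 * u) *\<^sub>R (sgn (Re w) *\<^sub>R h + t *\<^sub>R 1))"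
      proof -
        have "2 * u * sgn (Re w) = 2 * Re w"
          by (simp add: u_def abs_mult_sgn)
        then show ?thesis
          by (simp only: scaleR_add_right scaleR_scaleR tu add.commute[of "R\<^sup>2 *\<^sub>R 1"])
      qed
      also have "\<dots> \<le> 2 * u * (t + M)"
        using s[OF \<open>s \<le> t\<close>] u False by (auto simp: sgn_if)
      finally show ?thesis using tu by (simp add: distrib_left u_def)
    qed simp
    moreover have "2 * \<bar>Re w\<bar> * M \<le> 2 * R * M"
      using abs_Re_le_cmod[of w] w M0 by simp
    ultimately have "(norm (w *\<^sub>C 1 + h))\<^sup>2 \<le> R\<^sup>2 + 2 * R * M + (norm h)\<^sup>2"
      using norm_scalar_plus_selfadjoint[OF h, of w] w by simp
    also have "\<dots> \<le> R\<^sup>2 + 2 * R * M'" using R' by (simp add: algebra_simps)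
    also have "\<dots> \<le> (R + M')\<^sup>2" by (simp add: power2_eq_square algebra_simps)
    finally show "norm (w *\<^sub>C 1 + h) \<le> R + M'"
      by (rule power2_le_imp_le) (use R M0 in simp)
  qed
qed

lemma star_re_part: "star (re_part x) = re_part x"
  by (simp add: re_part_def star_scaleC star_add star_star add.commute)

lemma star_im_part: "star (im_part x) = im_part x"
proof -
  have "star (im_part x) = (- (1 / (2 * \<i>))) *\<^sub>C (star x - x)"
    by (simp add: im_part_def star_scaleC star_diff star_star)
  also have "\<dots> = im_part x"
    by (simp add: im_part_def scaleC_diff_right scaleC_minus_left)
  finally show ?thesis .
qed

lemma re_im_decomposition: "x = re_part x + \<i> *\<^sub>C im_part x"
proof -
  have "re_part x + \<i> *\<^sub>C im_part x = (1 / 2) *\<^sub>C (x + x)"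
    by (simp add: re_part_def im_part_def scaleC_scaleC flip: scaleC_add_right)
  also have "\<dots> = x" by (simp add: scaleC_add_right flip: scaleC_add_left)
  finally show ?thesis by simp
qed

lemma state_re_part:
  assumes "\<phi> \<in> states"
  shows "\<phi> (re_part x) = complex_of_real (Re (\<phi> x))"
proof -
  have "\<phi> x = \<phi> (re_part x) + \<i> * \<phi> (im_part x)"
    using re_im_decomposition[of x] linear_add[OF dual_space_linear[OF state_dual[OF assms]]]
      dual_space_scaleC[OF state_dual[OF assms]] by metis
  then show ?thesis
    using state_selfadjoint_real[OF assms star_re_part[of x]]
      state_selfadjoint_real[OF assms star_im_part[of x]] by (simp add: complex_eq_iff)
qed

lemma im_part_eq_re_part: "im_part x = re_part ((- \<i>) *\<^sub>C x)"
  by (simp add: im_part_def re_part_def star_scaleC star_minus scaleC_scaleC scaleC_add_right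
      scaleC_diff_right scaleC_minus_left)

lemma norm_re_part_le_numerical_radius:
  "norm (re_part (exp (\<i> * complex_of_real \<theta>) *\<^sub>C x)) \<le> numerical_radius x"
proof -
  let ?y = "exp (\<i> * complex_of_real \<theta>) *\<^sub>C x"
  have "norm (re_part ?y) \<le> numerical_radius (re_part ?y)"
    by (rule norm_selfadjoint_le_numerical_radius[OF star_re_part])
  also have "\<dots> \<le> numerical_radius x"
  proof (rule numerical_radius_least)
    fix \<phi> :: "'a \<Rightarrow> complex" assume \<phi>: "\<phi> \<in> states"
    have "cmod (\<phi> (re_part ?y)) \<le> cmod (\<phi> ?y)"
      by (simp add: state_re_part[OF \<phi>] abs_Re_le_cmod)
    also have "\<dots> = cmod (\<phi> x)"
      by (simp add: dual_space_scaleC[OF state_dual[OF \<phi>]] norm_mult)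
    also have "\<dots> \<le> numerical_radius x" by (rule numerical_radius_upper[OF \<phi>])
    finally show "cmod (\<phi> (re_part ?y)) \<le> numerical_radius x" .
  qed
  finally show ?thesis .
qed

lemma SUP_norm_re_part:
  "(SUP \<theta>::real. norm (re_part (exp (\<i> * complex_of_real \<theta>) *\<^sub>C x))) = numerical_radius x"
proof (rule antisym)
  show "(SUP \<theta>::real. norm (re_part (exp (\<i> * complex_of_real \<theta>) *\<^sub>C x))) \<le> numerical_radius x"
    by (rule cSUP_least) (simp_all add: norm_re_part_le_numerical_radius)
  show "numerical_radius x \<le> (SUP \<theta>::real. norm (re_part (exp (\<i> * complex_of_real \<theta>) *\<^sub>C x)))"
  proof (rule numerical_radius_least)
    fix \<phi> :: "'a \<Rightarrow> complex" assume \<phi>: "\<phi> \<in> states"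
    obtain \<theta> where \<theta>: "exp (\<i> * complex_of_real \<theta>) * \<phi> x = complex_of_real (cmod (\<phi> x))"
      using unit_rotation by blast
    let ?y = "exp (\<i> * complex_of_real \<theta>) *\<^sub>C x"
    have "\<phi> (re_part ?y) = complex_of_real (cmod (\<phi> x))"
      by (simp add: state_re_part[OF \<phi>] dual_space_scaleC[OF state_dual[OF \<phi>]] \<theta>)
    then have "cmod (\<phi> x) \<le> norm (re_part ?y)"
      using state_bound[OF \<phi>, of "re_part ?y"] by simp
    also have "\<dots> \<le> (SUP \<theta>::real. norm (re_part (exp (\<i> * complex_of_real \<theta>) *\<^sub>C x)))"
      by (rule cSUP_upper)
        (auto intro!: bdd_aboveI2[where M = "numerical_radius x"] norm_re_part_le_numerical_radius)
    finally show "cmod (\<phi> x) \<le> (SUP \<theta>::real. norm (re_part (exp (\<i> * complex_of_real \<theta>) *\<^sub>C x)))" .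
  qed
qed

lemma SUP_norm_im_part:
  "(SUP \<theta>::real. norm (im_part (exp (\<i> * complex_of_real \<theta>) *\<^sub>C x))) = numerical_radius x"
proof -
  define g where "g \<theta> = norm (re_part (exp (\<i> * complex_of_real \<theta>) *\<^sub>C x))" for \<theta> :: real
  have "- \<i> * exp (\<i> * complex_of_real \<theta>) = exp (\<i> * complex_of_real (\<theta> - pi / 2))" for \<theta>
    by (simp add: complex_eq_iff Re_exp Im_exp cos_diff sin_diff)
  then have "norm (im_part (exp (\<i> * complex_of_real \<theta>) *\<^sub>C x)) = g (\<theta> - pi / 2)" for \<theta>
    by (simp only: g_def im_part_eq_re_part scaleC_scaleC)
  then have "(SUP \<theta>. norm (im_part (exp (\<i> * complex_of_real \<theta>) *\<^sub>C x))) = Sup (g ` range (\<lambda>\<theta>. \<theta> - pi / 2))"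
    unfolding image_image by presburger
  also have "range (\<lambda>\<theta>::real. \<theta> - pi / 2) = UNIV"
    by (rule surjI[of _ "\<lambda>\<theta>. \<theta> + pi / 2"]) simp
  finally show ?thesis using SUP_norm_re_part[of x] by (simp add: g_def)
qed

theorem theorem2p2:
  fixes x :: "'a::cstar_algebra_1"
  shows "(SUP \<theta>::real. norm (re_part (exp (\<i> * complex_of_real \<theta>) *\<^sub>C x))) = numerical_radius x
       \<and> (SUP \<theta>::real. norm (im_part (exp (\<i> * complex_of_real \<theta>) *\<^sub>C x))) = numerical_radius x"
  using SUP_norm_re_part[of x] SUP_norm_im_part[of x] by blast

end
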